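(* Every element of the subgroup $$\left\{ \varphi \in \mathrm{GL}(\mathbb{R}^3):\; \varphi(X)=\begin{pmatrix}\lambda & 0 & 0\\ 0 & \mu & 0\\ 0& 0 & 1\end{pmatrix}\begin{pmatrix}x\\ y\\ z\end{pmatrix},\ \lambda,\mu\in\mathbb{R},\ \lambda \mu\ne 0\right\}$$ of the linear automorphism group of Sol space is $\infty$-harmonic as a map $(\mathbb{R}^3,g_{Sol})\to(\mathbb{R}^3,g_{Sol})$.
   Context: A smooth map $\varphi:(M,g)\to(N,h)$ between Riemannian manifolds is called $\infty$-harmonic if $\mathrm{d}\varphi(\mathrm{grad}\,|\mathrm{d}\varphi|^2)=0$ on $M$, where $|\mathrm{d}\varphi|^2=\mathrm{Trace}_g\,\varphi^*h$ is the energy density of $\varphi$ and $\mathrm{grad}$ is the gradient with respect to $g$. Sol space is $(\mathbb{R}^3,g_{Sol})$, where in the standard coordinates $(x,y,z)$ of $\mathbb{R}^3$: $g_{Sol}=e^{2z}\mathrm{d}x^2+e^{-2z}\mathrm{d}y^2+\mathrm{d}z^2$. The linear automorphism group of Sol space is the group $\mathrm{GL}(\mathbb{R}^3)$ of invertible maps $\mathbb{R}^3\to\mathbb{R}^3$ that are linear in these standard coordinates. *)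

theory Defs
  imports "HOL-Analysis.Analysis" "HOL-Algebra.Group"
begin

text \<open>\<open>C\<^sup>\<infinity>\<close>: all iterated directional derivatives exist and are Frechet differentiable.\<close>

primrec times_differentiable ::
    "nat \<Rightarrow> ('a::real_normed_vector \<Rightarrow> 'b::real_normed_vector) \<Rightarrow> bool" where
  "times_differentiable 0 f \<longleftrightarrow> continuous_on UNIV f"
| "times_differentiable (Suc k) f \<longleftrightarrow>
     (\<forall>p. f differentiable (at p)) \<and>
     (\<forall>v. times_differentiable k (\<lambda>p. frechet_derivative f (at p) v))"

definition smooth_map :: "('a::real_normed_vector \<Rightarrow> 'b::real_normed_vector) \<Rightarrow> bool" where
  "smooth_map f \<longleftrightarrow> (\<forall>k. times_differentiable k f)"

text \<open>A metric on the manifold \<open>real ^ 'n\<close> is a field of bilinear forms: \<open>g p u v\<close> is the inner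
  product of the tangent vectors \<open>u\<close> and \<open>v\<close> at \<open>p\<close>, every tangent space being identified with
  \<open>real ^ 'n\<close> by the standard coordinates.\<close>

type_synonym 'n tensor2 = "real ^ 'n \<Rightarrow> real ^ 'n \<Rightarrow> real ^ 'n \<Rightarrow> real"

definition riemannian_metric :: "('n::finite) tensor2 \<Rightarrow> bool" where
  "riemannian_metric g \<longleftrightarrow>
     (\<forall>p. bilinear (g p)) \<and>
     (\<forall>p u v. g p u v = g p v u) \<and>
     (\<forall>p u. u \<noteq> 0 \<longrightarrow> g p u u > 0) \<and>
     (\<forall>u v. smooth_map (\<lambda>p. g p u v))"

definition pullback ::
    "(real ^ 'm \<Rightarrow> real ^ 'n) \<Rightarrow> ('n::finite) tensor2 \<Rightarrow> ('m::finite) tensor2" where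
  "pullback \<phi> h p u v = h (\<phi> p) (frechet_derivative \<phi> (at p) u) (frechet_derivative \<phi> (at p) v)"

definition coeff_matrix :: "('n::finite) tensor2 \<Rightarrow> real ^ 'n \<Rightarrow> real ^ 'n ^ 'n" where
  "coeff_matrix B p = (\<chi> i j. B p (axis i 1) (axis j 1))"

text \<open>The metric trace \<open>g\<^sup>i\<^sup>j B\<^sub>i\<^sub>j\<close>, with \<open>g\<^sup>i\<^sup>j\<close> the inverse of the coefficient matrix of \<open>g\<close>.\<close>

definition trace_wrt :: "('n::finite) tensor2 \<Rightarrow> 'n tensor2 \<Rightarrow> real ^ 'n \<Rightarrow> real" where
  "trace_wrt g B p =
     (\<Sum>i\<in>UNIV. \<Sum>j\<in>UNIV. matrix_inv (coeff_matrix g p) $ i $ j * coeff_matrix B p $ i $ j)"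

definition energy_density ::
    "('m::finite) tensor2 \<Rightarrow> ('n::finite) tensor2 \<Rightarrow> (real ^ 'm \<Rightarrow> real ^ 'n) \<Rightarrow> real ^ 'm \<Rightarrow> real" where
  "energy_density g h \<phi> = trace_wrt g (pullback \<phi> h)"

definition grad :: "('n::finite) tensor2 \<Rightarrow> (real ^ 'n \<Rightarrow> real) \<Rightarrow> real ^ 'n \<Rightarrow> real ^ 'n" where
  "grad g f p = (THE w. \<forall>v. g p w v = frechet_derivative f (at p) v)"

definition infinity_harmonic ::
    "('m::finite) tensor2 \<Rightarrow> ('n::finite) tensor2 \<Rightarrow> (real ^ 'm \<Rightarrow> real ^ 'n) \<Rightarrow> bool" where
  "infinity_harmonic g h \<phi> \<longleftrightarrow>
     riemannian_metric g \<and> riemannian_metric h \<and> smooth_map \<phi> \<and>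
     (\<forall>p. frechet_derivative \<phi> (at p) (grad g (energy_density g h \<phi>) p) = 0)"

definition sol_metric :: "3 tensor2" where
  "sol_metric p u v =
     exp (2 * p $ 3) * u $ 1 * v $ 1 + exp (- 2 * p $ 3) * u $ 2 * v $ 2 + u $ 3 * v $ 3"

definition GL_R3 :: "(real ^ 3 \<Rightarrow> real ^ 3) monoid" where
  "GL_R3 = \<lparr>carrier = {\<phi>. linear \<phi> \<and> bij \<phi>}, mult = (\<circ>), one = id\<rparr>"

lemma group_GL_R3: "group GL_R3"
proof (rule groupI)
  fix x assume "x \<in> carrier GL_R3"
  then have x: "linear x" "bij x" by (auto simp: GL_R3_def)
  have "linear (inv_into UNIV x)" "bij (inv_into UNIV x)"
    using x by (simp_all add: bij_imp_bij_inv bij_is_inj inj_linear_imp_inv_linear)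
  moreover have "inv_into UNIV x \<circ> x = id" using x by (simp add: bij_is_inj)
  ultimately show "\<exists>y\<in>carrier GL_R3. y \<otimes>\<^bsub>GL_R3\<^esub> x = \<one>\<^bsub>GL_R3\<^esub>"
    by (auto simp: GL_R3_def)
qed (auto simp: GL_R3_def linear_compose bij_comp o_assoc linear_id)

definition sol_diagonal_group :: "(real ^ 3 \<Rightarrow> real ^ 3) set" where
  "sol_diagonal_group =
     {\<phi> \<in> carrier GL_R3. \<exists>l \<mu> :: real. l * \<mu> \<noteq> 0 \<and>
        (\<forall>X. \<phi> X = (vector [vector [l, 0, 0],
                          vector [0, \<mu>, 0],
                          vector [0, 0, 1]] :: real ^ 3 ^ 3) *v X)}"

end

theory Submission imports Defs begin

text \<open>A diagonal map with entries \<open>l, \<mu>, 1\<close> fixes the coordinate \<open>z\<close>, on which alone the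
  coefficients of the Sol metric depend. Hence its energy density is the constant
  \<open>l\<^sup>2 + \<mu>\<^sup>2 + 1\<close>, whose gradient vanishes.\<close>

text \<open>Induction on the order of differentiation: a directional derivative of a member is again
  a member, so the hypothesis on \<open>S\<close> applies at every order. To prove smoothness it is
  enough to exhibit such an invariant class.\<close>

lemma smooth_map_if_closed_under_derivatives:
  assumes "f \<in> S"
    and diff: "\<And>f p. f \<in> S \<Longrightarrow> f differentiable (at p)"
    and closed: "\<And>f v. f \<in> S \<Longrightarrow> (\<lambda>p. frechet_derivative f (at p) v) \<in> S"
  shows "smooth_map f"
proof -
  have "times_differentiable k f" if "f \<in> S" for k f
    using that
  proof (induction k arbitrary: f)
    case 0
    then show ?case
      by (simp add: continuous_at_imp_continuous_on diff differentiable_imp_continuous_within)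
  next
    case (Suc k)
    then show ?case
      by (simp add: diff closed)
  qed
  then show ?thesis
    using \<open>f \<in> S\<close> by (simp add: smooth_map_def)
qed

lemma frechet_derivative_bounded_linear:
  "bounded_linear f \<Longrightarrow> frechet_derivative f (at p) = f"
  by (metis bounded_linear_imp_has_derivative frechet_derivative_at)

lemma smooth_map_bounded_linear:
  assumes "bounded_linear f"
  shows "smooth_map f"
  \<comment> \<open>For fixed \<open>v\<close> the derivative of a linear map is the constant
    \<open>f v\<close>, and constants differentiate to the constant 0, so \<open>f\<close> together
    with the constants is closed.\<close>
  by (rule smooth_map_if_closed_under_derivatives[where S = "insert f (range (\<lambda>c _. c))"])
    (use assms in \<open>auto simp: frechet_derivative_bounded_linear bounded_linear_imp_differentiable\<close>)

lemma grad_const: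
  assumes "riemannian_metric g"
  shows "grad g (\<lambda>_. c) p = 0"
proof -
  have "bilinear (g p)" and pos: "\<And>u. u \<noteq> 0 \<Longrightarrow> g p u u > 0"
    using assms by (auto simp: riemannian_metric_def)
  then have "g p 0 v = 0" for v
    by (simp add: bilinear_lzero)
  then show ?thesis
    \<comment> \<open>Uniqueness for the description in \<open>grad\<close>: a vector
      \<open>w\<close> with \<open>g p w v = 0\<close> for all \<open>v\<close> can be tested
      against \<open>v = w\<close>, and positive definiteness forces \<open>w = 0\<close>.\<close>
    unfolding grad_def using pos by (intro the_equality) (auto, force)
qed

text \<open>For fixed \<open>u\<close> and \<open>v\<close>, the Sol metric as a function of the
  point has this shape. Differentiation only changes the coefficients, so the whole three-parameter
  family serves as the invariant class.\<close>

lemma smooth_map_exp_combination: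
  fixes a b c :: real
  shows "smooth_map (\<lambda>p :: real ^ 'n. a * exp (2 * p $ k) + b * exp (- 2 * p $ k) + c)"
proof -
  define F where "F = (\<lambda>a b c (p :: real ^ 'n). a * exp (2 * p $ k) + b * exp (- 2 * p $ k) + c)"
  have F: "(F a b c has_derivative (\<lambda>v. F (2 * a * v $ k) (- 2 * b * v $ k) 0 p)) (at p)" for a b c p
    unfolding F_def by (auto intro!: derivative_eq_intros bounded_linear_imp_has_derivative
        simp: algebra_simps)
  have dF: "(\<lambda>p. frechet_derivative (F a b c) (at p) v) = F (2 * a * v $ k) (- 2 * b * v $ k) 0"
    for a b c v
    by (rule ext) (simp flip: frechet_derivative_at[OF F])
  have "smooth_map (F a b c)"
  proof (rule smooth_map_if_closed_under_derivatives)
    show "F a b c \<in> {F a b c | a b c. True}"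
      by blast
  next
    fix f v assume "f \<in> {F a b c | a b c. True}"
    then obtain a b c where f: "f = F a b c"
      by blast
    show "f differentiable (at p)" for p
      unfolding f by (rule differentiableI[OF F])
    show "(\<lambda>p. frechet_derivative f (at p) v) \<in> {F a b c | a b c. True}"
      unfolding f dF by blast
  qed
  then show ?thesis
    by (simp only: F_def)
qed

lemma riemannian_metric_sol_metric: "riemannian_metric sol_metric"
  unfolding riemannian_metric_def
proof (intro conjI allI impI)
  show "bilinear (sol_metric p)" for p
    by (auto simp: bilinear_def sol_metric_def algebra_simps intro!: linearI)
  show "sol_metric p u v = sol_metric p v u" for p u v
    by (simp add: sol_metric_def algebra_simps)
  show "sol_metric p u u > 0" if "u \<noteq> 0" for p u
  proof -
    have "u $ 1 \<noteq> 0 \<or> u $ 2 \<noteq> 0 \<or> u $ 3 \<noteq> 0"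
      using that by (simp add: vec_eq_iff forall_3)
    then have "exp (2 * p $ 3) * (u $ 1)\<^sup>2 + exp (- 2 * p $ 3) * (u $ 2)\<^sup>2 + (u $ 3)\<^sup>2 > 0"
      by (elim disjE) (simp_all add: add_pos_nonneg add_nonneg_pos)
    then show ?thesis
      by (simp add: sol_metric_def power2_eq_square mult.assoc)
  qed
  show "smooth_map (\<lambda>p. sol_metric p u v)" for u v
    using smooth_map_exp_combination[of "u $ 1 * v $ 1" 3 "u $ 2 * v $ 2" "u $ 3 * v $ 3"]
    by (simp add: sol_metric_def mult_ac)
qed

text \<open>\<open>matrix_inv\<close> is a choice among two-sided inverses. For square matrices over
  a field a right inverse is also a left inverse, and two-sided inverses are unique.\<close>

lemma matrix_inv_eqI:
  fixes A B :: "'a::field ^ 'n ^ 'n"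
  assumes "A ** B = mat 1"
  shows "matrix_inv A = B"
proof -
  have "B ** A = mat 1"
    using assms by (simp add: matrix_left_right_inverse)
  then have "A ** matrix_inv A = mat 1"
    unfolding matrix_inv_def using assms by (metis (mono_tags, lifting) someI)
  then show ?thesis
    using \<open>B ** A = mat 1\<close> by (metis matrix_mul_assoc matrix_mul_lid matrix_mul_rid)
qed

lemma matrix_inv_coeff_matrix_sol_metric:
  "matrix_inv (coeff_matrix sol_metric p) =
    vector [vector [exp (- 2 * p $ 3), 0, 0], vector [0, exp (2 * p $ 3), 0], vector [0, 0, 1]]"
  by (rule matrix_inv_eqI)
    (simp add: vec_eq_iff forall_3 matrix_matrix_mult_def sum_3 mat_def coeff_matrix_def
      sol_metric_def axis_def flip: exp_add)

abbreviation diag_map :: "real \<Rightarrow> real \<Rightarrow> real ^ 3 \<Rightarrow> real ^ 3" where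
  "diag_map l \<mu> X \<equiv>
    (vector [vector [l, 0, 0], vector [0, \<mu>, 0], vector [0, 0, 1]] :: real ^ 3 ^ 3) *v X"

lemma diag_map_eq: "diag_map l \<mu> X = vector [l * X $ 1, \<mu> * X $ 2, X $ 3]"
  by (simp add: vec_eq_iff forall_3 matrix_vector_mult_def sum_3)

lemma bounded_linear_diag_map: "bounded_linear (diag_map l \<mu>)"
  by (simp add: linear_conv_bounded_linear[symmetric])

lemma diag_map_comp: "diag_map l \<mu> \<circ> diag_map l' \<mu>' = diag_map (l * l') (\<mu> * \<mu>')"
  by (simp add: fun_eq_iff diag_map_eq mult.assoc)

lemma diag_map_1: "diag_map 1 1 = id"
  by (simp add: fun_eq_iff diag_map_eq vec_eq_iff forall_3)

lemma diag_map_inverse: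
  assumes "l * \<mu> \<noteq> 0"
  shows "diag_map (1 / l) (1 / \<mu>) \<circ> diag_map l \<mu> = id"
    and "diag_map l \<mu> \<circ> diag_map (1 / l) (1 / \<mu>) = id"
  \<comment> \<open>The composite is first merged into a single \<open>diag_map\<close>; then
    \<open>id\<close> is rewritten as \<open>diag_map 1 1\<close>, which leaves only arithmetic on
    the entries.\<close>
  using assms by (simp_all only: diag_map_comp) (simp_all flip: diag_map_1)

text \<open>Membership in \<open>GL_R3\<close> is automatic: when the product of the entries is
  nonzero, the map with reciprocal entries is a two-sided inverse.\<close>

lemma sol_diagonal_group_eq:
  "sol_diagonal_group = {diag_map l \<mu> | l \<mu>. l * \<mu> \<noteq> 0}"
proof -
  have "diag_map l \<mu> \<in> carrier GL_R3" if "l * \<mu> \<noteq> 0" for l \<mu>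
    using o_bij[OF diag_map_inverse[OF that]] by (simp add: GL_R3_def)
  then show ?thesis
    \<comment> \<open>The pointwise description of \<phi> is folded into an equation between
      functions.\<close>
    unfolding sol_diagonal_group_def by (simp only: fun_eq_iff[symmetric]) blast
qed

lemma subgroup_sol_diagonal_group: "subgroup sol_diagonal_group GL_R3"
proof (rule group.subgroupI[OF group_GL_R3])
  show sub: "sol_diagonal_group \<subseteq> carrier GL_R3"
    by (auto simp: sol_diagonal_group_def)
  show "sol_diagonal_group \<noteq> {}"
    unfolding sol_diagonal_group_eq by (auto intro!: exI[of _ 1])
  fix \<phi> assume \<phi>: "\<phi> \<in> sol_diagonal_group"
  then obtain l \<mu> where l\<mu>: "\<phi> = diag_map l \<mu>" "l * \<mu> \<noteq> 0"
    unfolding sol_diagonal_group_eq by blast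
  have inv_mem: "diag_map (1 / l) (1 / \<mu>) \<in> sol_diagonal_group"
    unfolding sol_diagonal_group_eq using l\<mu>(2)
    by (intro CollectI exI[of _ "1 / l"] exI[of _ "1 / \<mu>"]) simp
  \<comment> \<open>In a group a left inverse within the carrier is the inverse, which identifies
    the abstract \<open>inv\<close> with the explicit map.\<close>
  have "inv\<^bsub>GL_R3\<^esub> \<phi> = diag_map (1 / l) (1 / \<mu>)"
  proof (rule group.inv_equality[OF group_GL_R3])
    show "diag_map (1 / l) (1 / \<mu>) \<otimes>\<^bsub>GL_R3\<^esub> \<phi> = \<one>\<^bsub>GL_R3\<^esub>"
      using diag_map_inverse(1)[OF l\<mu>(2)] by (simp add: GL_R3_def l\<mu>(1))
  qed (use sub \<phi> inv_mem in auto)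
  then show "inv\<^bsub>GL_R3\<^esub> \<phi> \<in> sol_diagonal_group"
    using inv_mem by simp
  fix \<psi> assume "\<psi> \<in> sol_diagonal_group"
  then obtain l' \<mu>' where l\<mu>': "\<psi> = diag_map l' \<mu>'" "l' * \<mu>' \<noteq> 0"
    unfolding sol_diagonal_group_eq by blast
  have "\<phi> \<otimes>\<^bsub>GL_R3\<^esub> \<psi> = diag_map (l * l') (\<mu> * \<mu>')"
    by (simp add: GL_R3_def l\<mu> l\<mu>' diag_map_comp)
  moreover have "(l * l') * (\<mu> * \<mu>') \<noteq> 0"
    using l\<mu>(2) l\<mu>'(2) by simp
  ultimately show "\<phi> \<otimes>\<^bsub>GL_R3\<^esub> \<psi> \<in> sol_diagonal_group"
    unfolding sol_diagonal_group_eq by blast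
qed

lemma energy_density_diag_map:
  "energy_density sol_metric sol_metric (diag_map l \<mu>) = (\<lambda>_. l\<^sup>2 + \<mu>\<^sup>2 + 1)"
proof
  fix p
  \<comment> \<open>The pullback takes the metric at the image point, whose third coordinate is
    still \<open>p $ 3\<close>. The exponential weights are thus those at \<open>p\<close>, and the
    derivative, being the map itself, contributes the squared entries.\<close>
  have "coeff_matrix (pullback (diag_map l \<mu>) sol_metric) p =
      vector [vector [exp (2 * p $ 3) * l\<^sup>2, 0, 0], vector [0, exp (- 2 * p $ 3) * \<mu>\<^sup>2, 0],
        vector [0, 0, 1]]"
    unfolding coeff_matrix_def pullback_def
      frechet_derivative_bounded_linear[OF bounded_linear_diag_map]
    by (simp add: vec_eq_iff forall_3 sol_metric_def diag_map_eq axis_def power2_eq_square)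
  then show "energy_density sol_metric sol_metric (diag_map l \<mu>) p = l\<^sup>2 + \<mu>\<^sup>2 + 1"
    unfolding energy_density_def trace_wrt_def
    \<comment> \<open>Each weight meets its reciprocal from the inverse metric; reading
      \<open>exp_add\<close> backwards merges the two into \<open>exp 0\<close>.\<close>
    by (simp add: matrix_inv_coeff_matrix_sol_metric sum_3 mult.assoc[symmetric] flip: exp_add)
qed

lemma infinity_harmonic_diag_map: "infinity_harmonic sol_metric sol_metric (diag_map l \<mu>)"
  unfolding infinity_harmonic_def energy_density_diag_map
  by (simp add: riemannian_metric_sol_metric smooth_map_bounded_linear bounded_linear_diag_map
      grad_const frechet_derivative_bounded_linear)

theorem corollary4p2:
  shows "subgroup sol_diagonal_group GL_R3 \<and>
    (\<forall>\<phi> \<in> sol_diagonal_group. infinity_harmonic sol_metric sol_metric \<phi>)"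
  using subgroup_sol_diagonal_group infinity_harmonic_diag_map
  by (auto simp: sol_diagonal_group_eq)

end
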